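(* Any symmetric generalized complex structure $\mathcal J$ on a finite-dimensional real vector space $V$ is a $B$-field transformation of the direct sum of a symmetric generalized complex structure determined by a complex structure and one determined by a pseudo-Euclidean metric. That is, there are a decomposition $V=\Delta\oplus N$ (either summand possibly zero), a pseudo-Euclidean metric $g$ on $\Delta$, a complex structure $J$ on $N$ and a 2-form $B\in\Lambda^2(V^* )$ such that $$\exp(B)\circ\mathcal J\circ\exp(-B)=\mathcal J_g\oplus\mathcal J_J$$ on $V\oplus V^*=(\Delta\oplus\Delta^* )\oplus(N\oplus N^* )$.
   Context: On $V\oplus V^*$ consider the metric $g_{\mathrm{can}}(X+\xi,Y+\eta)=\frac12(\xi(Y)+\eta(X))$. A symmetric generalized complex structure on $V$ is an endomorphism $\mathcal J$ of $V\oplus V^*$, symmetric with respect to $g_{\mathrm{can}}$, with $\mathcal J^2=-\mathrm{Id}$. A complex structure $J$ on $N$ determines the symmetric generalized complex structure $\mathcal J_J=\begin{pmatrix}J&0\\0&J^*\end{pmatrix}$ on $N$, where $J^*\xi=\xi\circ J$. A pseudo-Euclidean metric (non-degenerate symmetric bilinear form of any signature), seen as a map $g:\Delta\to\Delta^*$, determines the symmetric generalized complex structure $\mathcal J_g=\begin{pmatrix}0&g^{-1}\\-g&0\end{pmatrix}$ on $\Delta$. For $B\in\Lambda^2(V^* )$, $\exp(B):V\oplus V^*\to V\oplus V^*$ is $X+\xi\mapsto X+i_XB+\xi$, and the $B$-field transformation of $\mathcal J$ is $\exp(B)\circ\mathcal J\circ\exp(-B)$. *)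

theory Defs
  imports "HOL-Analysis.Analysis"
begin

typedef (overloaded) ('a::real_vector) dual_space = "{\<xi> :: 'a \<Rightarrow> real. linear \<xi>}"
  morphisms dual_apply Dual
  by (rule exI[of _ "\<lambda>_. 0"]) (simp add: linear_iff)

setup_lifting type_definition_dual_space

instantiation dual_space :: (real_vector) real_vector
begin

lift_definition zero_dual_space :: "'a dual_space" is "\<lambda>_. 0"
  by (simp add: linear_iff)

lift_definition plus_dual_space :: "'a dual_space \<Rightarrow> 'a dual_space \<Rightarrow> 'a dual_space"
  is "\<lambda>\<xi> \<eta> X. \<xi> X + \<eta> X"
  by (simp add: linear_iff algebra_simps)

lift_definition uminus_dual_space :: "'a dual_space \<Rightarrow> 'a dual_space"
  is "\<lambda>\<xi> X. - \<xi> X"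
  by (simp add: linear_iff algebra_simps)

lift_definition minus_dual_space :: "'a dual_space \<Rightarrow> 'a dual_space \<Rightarrow> 'a dual_space"
  is "\<lambda>\<xi> \<eta> X. \<xi> X - \<eta> X"
  by (simp add: linear_iff algebra_simps)

lift_definition scaleR_dual_space :: "real \<Rightarrow> 'a dual_space \<Rightarrow> 'a dual_space"
  is "\<lambda>c \<xi> X. c * \<xi> X"
  by (simp add: linear_iff algebra_simps)

instance
  by standard (transfer; simp add: fun_eq_iff algebra_simps)+

end

definition g_can :: "('a::real_vector) \<times> 'a dual_space \<Rightarrow> 'a \<times> 'a dual_space \<Rightarrow> real" where
  "g_can = (\<lambda>(X, \<xi>) (Y, \<eta>). (dual_apply \<xi> Y + dual_apply \<eta> X) / 2)"

definition sym_gen_complex_structure ::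
    "(('a::real_vector) \<times> 'a dual_space \<Rightarrow> 'a \<times> 'a dual_space) \<Rightarrow> bool" where
  "sym_gen_complex_structure \<J> \<longleftrightarrow>
     linear \<J> \<and> (\<forall>x y. g_can (\<J> x) y = g_can x (\<J> y)) \<and> (\<forall>x. \<J> (\<J> x) = - x)"

definition two_form :: "('a::real_vector \<Rightarrow> 'a \<Rightarrow> real) \<Rightarrow> bool" where
  "two_form B \<longleftrightarrow> bilinear B \<and> (\<forall>X. B X X = 0)"

definition interior_mult :: "'a \<Rightarrow> ('a \<Rightarrow> 'a \<Rightarrow> real) \<Rightarrow> ('a::real_vector) dual_space" where
  "interior_mult X B = Dual (\<lambda>Y. B X Y)"

definition exp_form ::
    "('a::real_vector \<Rightarrow> 'a \<Rightarrow> real) \<Rightarrow> 'a \<times> 'a dual_space \<Rightarrow> 'a \<times> 'a dual_space" where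
  "exp_form B = (\<lambda>(X, \<xi>). (X, interior_mult X B + \<xi>))"

definition B_field_transform ::
    "('a::real_vector \<Rightarrow> 'a \<Rightarrow> real) \<Rightarrow> ('a \<times> 'a dual_space \<Rightarrow> 'a \<times> 'a dual_space)
       \<Rightarrow> 'a \<times> 'a dual_space \<Rightarrow> 'a \<times> 'a dual_space" where
  "B_field_transform B \<J> = exp_form B \<circ> \<J> \<circ> exp_form (\<lambda>X Y. - B X Y)"

text \<open>The summands of V are subspaces S of the ambient type.  A covector on S is a function
  that is linear on S and \<^const>\<open>undefined\<close> outside S, so that equality of such functions is
  equality of functionals on S; elements of the sum of S and its dual are pairs of type
  \<^typ>\<open>'a \<times> ('a \<Rightarrow> real)\<close>.\<close>

definition linear_on :: "'a::real_vector set \<Rightarrow> ('a \<Rightarrow> 'b::real_vector) \<Rightarrow> bool" where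
  "linear_on S f \<longleftrightarrow>
     (\<forall>X\<in>S. \<forall>Y\<in>S. f (X + Y) = f X + f Y) \<and> (\<forall>c. \<forall>X\<in>S. f (c *\<^sub>R X) = c *\<^sub>R f X)"

definition pseudo_euclidean_metric_on :: "'a::real_vector set \<Rightarrow> ('a \<Rightarrow> 'a \<Rightarrow> real) \<Rightarrow> bool" where
  "pseudo_euclidean_metric_on S g \<longleftrightarrow>
     (\<forall>X\<in>S. linear_on S (\<lambda>Y. g X Y)) \<and> (\<forall>Y\<in>S. linear_on S (\<lambda>X. g X Y)) \<and>
     (\<forall>X\<in>S. \<forall>Y\<in>S. g X Y = g Y X) \<and>
     (\<forall>X\<in>S. (\<forall>Y\<in>S. g X Y = 0) \<longrightarrow> X = 0)"

definition complex_structure_on :: "'a::real_vector set \<Rightarrow> ('a \<Rightarrow> 'a) \<Rightarrow> bool" where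
  "complex_structure_on S J \<longleftrightarrow>
     J \<in> S \<rightarrow> S \<and> linear_on S J \<and> (\<forall>X\<in>S. J (J X) = - X)"

definition flat_map :: "'a set \<Rightarrow> ('a \<Rightarrow> 'a \<Rightarrow> real) \<Rightarrow> 'a \<Rightarrow> 'a \<Rightarrow> real" where
  "flat_map S g X = (\<lambda>Y\<in>S. g X Y)"

text \<open>For g non-degenerate and S finite-dimensional, \<^term>\<open>flat_map S g\<close> is a bijection from S onto
  the covectors on S, so that \<^const>\<open>inv_into\<close> is its genuine inverse.\<close>

definition metric_gcs ::
    "'a set \<Rightarrow> ('a \<Rightarrow> 'a \<Rightarrow> real) \<Rightarrow> 'a \<times> ('a \<Rightarrow> real) \<Rightarrow> 'a \<times> ('a \<Rightarrow> real)" where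
  "metric_gcs S g = (\<lambda>(X, \<xi>). (inv_into S (flat_map S g) \<xi>, \<lambda>Y\<in>S. - flat_map S g X Y))"

definition complex_gcs ::
    "'a set \<Rightarrow> ('a \<Rightarrow> 'a) \<Rightarrow> 'a \<times> ('a \<Rightarrow> real) \<Rightarrow> 'a \<times> ('a \<Rightarrow> real)" where
  "complex_gcs S J = (\<lambda>(X, \<xi>). (J X, \<lambda>Y\<in>S. \<xi> (J Y)))"

definition is_direct_sum :: "'a::real_vector set \<Rightarrow> 'a set \<Rightarrow> bool" where
  "is_direct_sum S T \<longleftrightarrow>
     subspace S \<and> subspace T \<and> S \<inter> T = {0} \<and> {X + Y | X Y. X \<in> S \<and> Y \<in> T} = UNIV"

definition proj_along :: "'a::real_vector set \<Rightarrow> 'a set \<Rightarrow> 'a \<Rightarrow> 'a" where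
  "proj_along S T v = (THE X. X \<in> S \<and> v - X \<in> T)"

text \<open>A covector on V corresponds to the pair of its restrictions to S and T; conversely a pair
  of covectors on S and T corresponds to the sum of their pullbacks along the projections.\<close>

definition split_double ::
    "'a set \<Rightarrow> 'a set \<Rightarrow> ('a::real_vector) \<times> 'a dual_space
       \<Rightarrow> ('a \<times> ('a \<Rightarrow> real)) \<times> ('a \<times> ('a \<Rightarrow> real))" where
  "split_double S T = (\<lambda>(v, \<alpha>).
     ((proj_along S T v, restrict (dual_apply \<alpha>) S),
      (proj_along T S v, restrict (dual_apply \<alpha>) T)))"

definition join_double ::
    "'a set \<Rightarrow> 'a set \<Rightarrow> ('a \<times> ('a \<Rightarrow> real)) \<times> ('a \<times> ('a \<Rightarrow> real))
       \<Rightarrow> ('a::real_vector) \<times> 'a dual_space" where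
  "join_double S T = (\<lambda>((X, \<xi>), (Y, \<eta>)).
     (X + Y, Dual (\<lambda>w. \<xi> (proj_along S T w) + \<eta> (proj_along T S w))))"

definition direct_sum_gcs ::
    "'a set \<Rightarrow> 'a set \<Rightarrow> ('a \<times> ('a \<Rightarrow> real) \<Rightarrow> 'a \<times> ('a \<Rightarrow> real))
       \<Rightarrow> ('a \<times> ('a \<Rightarrow> real) \<Rightarrow> 'a \<times> ('a \<Rightarrow> real))
       \<Rightarrow> ('a::real_vector) \<times> 'a dual_space \<Rightarrow> 'a \<times> 'a dual_space" where
  "direct_sum_gcs S T \<A> \<B> = join_double S T \<circ> map_prod \<A> \<B> \<circ> split_double S T"

end

theory Submission
  imports Defs
begin

text \<open>Write \<open>\<J>\<close> in blocks \<open>A : V \<rightarrow> V\<close>, \<open>\<beta> : V* \<rightarrow> V\<close>, \<open>\<sigma> : V \<rightarrow> V*\<close> and \<open>A*\<close>, with \<open>\<beta>\<close> and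
  \<open>\<sigma>\<close> symmetric.  The image \<open>\<Delta>\<close> of \<open>\<beta>\<close> carries the metric \<open>g(\<beta> \<xi>, \<beta> \<eta>) = \<xi> (\<beta> \<eta>)\<close>.
  A \<open>B\<close>-field transformation fixes \<open>\<beta>\<close> and replaces \<open>A\<close> by \<open>A - \<beta> B\<close>.  Let \<open>p\<close> be a projection
  onto \<open>\<Delta>\<close>.  Because \<open>A \<beta> = - \<beta> A*\<close>, the form \<open>g(A X, Y)\<close> is alternating on \<open>\<Delta>\<close>; it extends to
  a 2-form \<open>B\<close> on \<open>V\<close> with \<open>\<beta> B = p A\<close>, after which \<open>A\<close> vanishes on \<open>\<Delta>\<close> and maps into the kernel
  \<open>N\<close> of \<open>p\<close>, where \<open>A\<^sup>2 = -1\<close>.  A second transformation, with \<open>B(X, Y) = \<sigma>(A X, Y) / 2\<close>,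
  does not change \<open>A\<close> and makes \<open>\<sigma>\<close> vanish on \<open>N\<close>.\<close>

section \<open>Covectors and their evaluation\<close>

lemma linear_dual_apply: "linear (dual_apply \<xi>)"
  using dual_apply by auto

lemmas dual_apply_arith =
  linear_add[OF linear_dual_apply] linear_diff[OF linear_dual_apply]
  linear_neg[OF linear_dual_apply] linear_0[OF linear_dual_apply]
  linear_cmul[OF linear_dual_apply, unfolded real_scaleR_def]
  plus_dual_space.rep_eq minus_dual_space.rep_eq uminus_dual_space.rep_eq
  zero_dual_space.rep_eq scaleR_dual_space.rep_eq

lemma dual_eqI: "(\<And>X. dual_apply \<xi> X = dual_apply \<eta> X) \<Longrightarrow> \<xi> = \<eta>"
  by (simp add: dual_apply_inject[symmetric] fun_eq_iff)

lemma dual_separates: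
  assumes "\<And>\<xi>. dual_apply \<xi> X = 0"
  shows "X = 0"
proof (rule ccontr)
  assume "X \<noteq> 0"
  then have "independent {X}" by simp
  then obtain f :: "'a \<Rightarrow> real" where "linear f" "f X = 1"
    using linear_independent_extend[of "{X}" "\<lambda>_. 1"] by auto
  then show False using assms[of "Dual f"] by (simp add: Dual_inverse)
qed

lemma dual_apply_interior_mult:
  assumes "bilinear B"
  shows "dual_apply (interior_mult X B) Y = B X Y"
  using assms by (simp add: interior_mult_def bilinear_def Dual_inverse)

section \<open>Blocks and the group of \<open>B\<close>-field transformations\<close>

definition tangent_block where "tangent_block \<J> X = fst (\<J> (X, 0))"
definition bivector_block where "bivector_block \<J> \<xi> = fst (\<J> (0, \<xi>))"
definition form_block where "form_block \<J> X = snd (\<J> (X, 0))"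

lemma two_form_antisym:
  assumes "two_form B"
  shows "B X Y = - B Y X"
proof -
  have "bilinear B" "B (X + Y) (X + Y) = 0" "B X X = 0" "B Y Y = 0"
    using assms by (auto simp: two_form_def)
  then show ?thesis by (simp add: bilinear_ladd bilinear_radd)
qed

lemma bilinear_uminus: "bilinear B \<Longrightarrow> bilinear (\<lambda>X Y. - B X Y :: real)"
  by (auto simp: bilinear_def intro: linear_compose_neg)

lemma exp_form_uminus:
  assumes "bilinear B"
  shows "exp_form (\<lambda>X Y. - B X Y) (X, \<xi>) = (X, \<xi> - interior_mult X B)"
  using assms
  by (auto simp: exp_form_def dual_apply_interior_mult bilinear_uminus dual_apply_arith
      intro!: dual_eqI)

lemma linear_exp_form:
  assumes "bilinear B"
  shows "linear (exp_form B)"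
  using assms
  by (auto simp: exp_form_def linear_iff dual_apply_interior_mult dual_apply_arith
      bilinear_ladd bilinear_lmul algebra_simps intro!: dual_eqI)

lemma exp_form_inverse:
  assumes "bilinear B"
  shows "exp_form B (exp_form (\<lambda>X Y. - B X Y) x) = x" "exp_form (\<lambda>X Y. - B X Y) (exp_form B x) = x"
proof -
  have E: "exp_form B (X, \<xi>) = (X, interior_mult X B + \<xi>)" for X \<xi>
    by (simp add: exp_form_def)
  show "exp_form B (exp_form (\<lambda>X Y. - B X Y) x) = x" "exp_form (\<lambda>X Y. - B X Y) (exp_form B x) = x"
    by (cases x, simp add: exp_form_uminus[OF assms] E)+
qed

text \<open>The extra terms \<open>B X Y\<close> and \<open>B Y X\<close> cancel by
  antisymmetry.\<close>

lemma g_can_exp_form: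
  assumes "two_form B"
  shows "g_can (exp_form B x) (exp_form B y) = g_can x y"
proof -
  have "bilinear B" using assms by (simp add: two_form_def)
  then show ?thesis using two_form_antisym[OF assms, of "fst x" "fst y"]
    by (cases x, cases y) (simp add: g_can_def exp_form_def dual_apply_interior_mult dual_apply_arith)
qed

text \<open>As an isometry of \<open>g_can\<close>, \<open>exp_form B\<close> has its inverse as
  adjoint, so conjugation by it preserves both symmetry and the square.\<close>

lemma sym_gen_complex_structure_B_field_transform:
  assumes "sym_gen_complex_structure \<J>" "two_form B"
  shows "sym_gen_complex_structure (B_field_transform B \<J>)"
proof -
  let ?E = "exp_form B" and ?F = "exp_form (\<lambda>X Y. - B X Y)"
  have bB: "bilinear B" using assms by (simp add: two_form_def)
  note inv = exp_form_inverse[OF bB]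
  have lin: "linear \<J>" and sym: "\<And>x y. g_can (\<J> x) y = g_can x (\<J> y)"
    and sq: "\<And>x. \<J> (\<J> x) = - x"
    using assms(1) by (auto simp: sym_gen_complex_structure_def)
  have lE: "linear ?E" "linear ?F"
    using bB by (auto intro: linear_exp_form bilinear_uminus)
  have adj: "g_can (?E x) y = g_can x (?F y)" "g_can (?F x) y = g_can x (?E y)" for x y
    using g_can_exp_form[OF assms(2), of x "?F y"] g_can_exp_form[OF assms(2), of "?F x" y]
    by (auto simp: inv)
  have "linear (B_field_transform B \<J>)"
    unfolding B_field_transform_def by (intro linear_compose lE lin)
  moreover have "?E (- x) = - ?E x" for x
    using lE by (simp add: linear_neg)
  ultimately show ?thesis
    by (simp add: sym_gen_complex_structure_def B_field_transform_def inv sq sym adj)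
qed

text \<open>Exponentials of 2-forms compose by adding the forms; this merges the two successive
  normalisations into one.\<close>

lemma B_field_transform_add:
  assumes "bilinear B" "bilinear C"
  shows "B_field_transform C (B_field_transform B \<J>) = B_field_transform (\<lambda>X Y. B X Y + C X Y) \<J>"
proof -
  have s: "bilinear (\<lambda>X Y. B X Y + C X Y)"
    using assms by (auto simp: bilinear_def intro: linear_compose_add)
  have i: "interior_mult X (\<lambda>X Y. B X Y + C X Y) = interior_mult X B + interior_mult X C" for X
    using assms s by (intro dual_eqI) (simp add: dual_apply_interior_mult dual_apply_arith)
  have "exp_form C (exp_form B x) = exp_form (\<lambda>X Y. B X Y + C X Y) x" for x
    by (cases x) (simp add: exp_form_def i)
  moreover have "exp_form (\<lambda>X Y. - B X Y) (exp_form (\<lambda>X Y. - C X Y) x)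
      = exp_form (\<lambda>X Y. - (B X Y + C X Y)) x" for x
    using exp_form_uminus[OF s] assms by (cases x) (simp add: exp_form_uminus i)
  ultimately show ?thesis
    by (simp add: B_field_transform_def fun_eq_iff)
qed

section \<open>Block identities from symmetry and from the square\<close>

locale sgcs =
  fixes \<J> :: "('a::real_vector) \<times> 'a dual_space \<Rightarrow> 'a \<times> 'a dual_space"
  assumes sgcs: "sym_gen_complex_structure \<J>"
begin

abbreviation "A \<equiv> tangent_block \<J>"
abbreviation "\<beta> \<equiv> bivector_block \<J>"
abbreviation "\<sigma> X Y \<equiv> dual_apply (form_block \<J> X) Y"

lemma linear_J: "linear \<J>"
  using sgcs unfolding sym_gen_complex_structure_def by blast

lemma linear_A: "linear A"
  unfolding tangent_block_def
  by (rule linear_compose[OF linear_compose[OF _ linear_J] linear_fst, unfolded o_def])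
    (simp add: linear_iff)

lemma linear_\<beta>: "linear \<beta>"
  unfolding bivector_block_def
  by (rule linear_compose[OF linear_compose[OF _ linear_J] linear_fst, unfolded o_def])
    (simp add: linear_iff)

lemma linear_form_block: "linear (form_block \<J>)"
  unfolding form_block_def
  by (rule linear_compose[OF linear_compose[OF _ linear_J] linear_snd, unfolded o_def])
    (simp add: linear_iff)

lemmas A_arith = linear_add[OF linear_A] linear_diff[OF linear_A] linear_neg[OF linear_A]
  linear_0[OF linear_A] linear_cmul[OF linear_A]
lemmas \<beta>_arith = linear_add[OF linear_\<beta>] linear_diff[OF linear_\<beta>] linear_neg[OF linear_\<beta>]
  linear_0[OF linear_\<beta>] linear_cmul[OF linear_\<beta>]
lemmas \<sigma>_arith = linear_add[OF linear_form_block] linear_diff[OF linear_form_block]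
  linear_neg[OF linear_form_block] linear_0[OF linear_form_block] linear_cmul[OF linear_form_block]
  dual_apply_arith

text \<open>Symmetry under \<open>g_can\<close> with the factor 1/2 cleared. Setting two of the four
  arguments to zero relates the individual blocks.\<close>

lemma J_sym: "dual_apply (snd (\<J> (X, \<xi>))) Y + dual_apply \<eta> (fst (\<J> (X, \<xi>)))
    = dual_apply \<xi> (fst (\<J> (Y, \<eta>))) + dual_apply (snd (\<J> (Y, \<eta>))) X"
proof -
  have "g_can (\<J> (X, \<xi>)) (Y, \<eta>) = g_can (X, \<xi>) (\<J> (Y, \<eta>))"
    using sgcs unfolding sym_gen_complex_structure_def by blast
  then show ?thesis by (simp add: g_can_def case_prod_beta)
qed

lemma J_split: "\<J> (X, \<xi>) = \<J> (X, 0) + \<J> (0, \<xi>)"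
  using linear_add[OF linear_J, of "(X, 0)" "(0, \<xi>)"] by simp

lemma J_square: "\<J> (\<J> x) = - x"
  using sgcs unfolding sym_gen_complex_structure_def by blast

lemma fst_J: "fst (\<J> (X, \<xi>)) = A X + \<beta> \<xi>"
  by (subst J_split) (simp add: tangent_block_def bivector_block_def)

lemma snd_J_0: "dual_apply (snd (\<J> (0, \<xi>))) Y = dual_apply \<xi> (A Y)"
  using J_sym[of 0 \<xi> Y 0] by (simp add: tangent_block_def dual_apply_arith)

lemma snd_J: "dual_apply (snd (\<J> (X, \<xi>))) Y = \<sigma> X Y + dual_apply \<xi> (A Y)"
  by (subst J_split) (simp add: form_block_def dual_apply_arith snd_J_0)

lemma \<sigma>_sym: "\<sigma> X Y = \<sigma> Y X"
  using J_sym[of X 0 Y 0] by (simp add: form_block_def dual_apply_arith)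

lemma \<beta>_sym: "dual_apply \<eta> (\<beta> \<xi>) = dual_apply \<xi> (\<beta> \<eta>)"
  using J_sym[of 0 \<xi> 0 \<eta>] by (simp add: bivector_block_def dual_apply_arith)

text \<open>This and the next two lemmas are components of \<open>\<J> (\<J> x) = - x\<close>: both
  components at \<open>(X, 0)\<close>, then the vector component at
  \<open>(0, \<xi>)\<close>.\<close>

lemma A_square: "A (A X) + \<beta> (form_block \<J> X) = - X"
  using fst_J[of "A X" "form_block \<J> X"] J_square[of "(X, 0)"]
  by (simp add: tangent_block_def form_block_def)

lemma \<sigma>_A: "\<sigma> (A X) Y = - \<sigma> X (A Y)"
  using snd_J[of "A X" "form_block \<J> X" Y] J_square[of "(X, 0)"]
  by (simp add: tangent_block_def form_block_def dual_apply_arith)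

lemma A_\<beta>: "A (\<beta> \<xi>) = - \<beta> (snd (\<J> (0, \<xi>)))"
  using fst_J[of "\<beta> \<xi>" "snd (\<J> (0, \<xi>))"] J_square[of "(0, \<xi>)"]
  by (simp add: bivector_block_def add_eq_0_iff2)

section \<open>The metric on the image of \<beta>\<close>

lemma \<beta>_eq_iff: "\<beta> \<xi> = \<beta> \<eta> \<longleftrightarrow> (\<forall>Y\<in>range \<beta>. dual_apply \<xi> Y = dual_apply \<eta> Y)"
proof
  assume "\<forall>Y\<in>range \<beta>. dual_apply \<xi> Y = dual_apply \<eta> Y"
  \<comment> \<open>Symmetry of \<beta> turns the left side into the difference of \<xi> and \<eta>
    evaluated at \<open>\<beta> \<zeta>\<close>.\<close>
  then have "dual_apply \<zeta> (\<beta> \<xi> - \<beta> \<eta>) = 0" for \<zeta>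
    by (simp add: dual_apply_arith \<beta>_sym[of \<zeta>])
  then have "\<beta> \<xi> - \<beta> \<eta> = 0" by (rule dual_separates)
  then show "\<beta> \<xi> = \<beta> \<eta>" by simp
next
  assume "\<beta> \<xi> = \<beta> \<eta>"
  then show "\<forall>Y\<in>range \<beta>. dual_apply \<xi> Y = dual_apply \<eta> Y"
    by (auto simp: \<beta>_sym[of \<xi>] \<beta>_sym[of \<eta>])
qed

text \<open>\<open>inv \<beta>\<close> picks an arbitrary preimage. By \<open>\<beta>_eq_iff\<close>
  the choice does not affect the value for \<open>X\<close> and \<open>Y\<close> in the image of
  \<beta>.\<close>

definition "g X Y = dual_apply (inv \<beta> X) Y"

lemma \<beta>_inv: "X \<in> range \<beta> \<Longrightarrow> \<beta> (inv \<beta> X) = X"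
  by (rule f_inv_into_f)

lemma g_\<beta>:
  assumes "Y \<in> range \<beta>"
  shows "g (\<beta> \<xi>) Y = dual_apply \<xi> Y"
proof -
  have "\<beta> (inv \<beta> (\<beta> \<xi>)) = \<beta> \<xi>" by (rule \<beta>_inv) simp
  then show ?thesis using assms by (auto simp: g_def \<beta>_eq_iff)
qed

lemma pseudo_euclidean_metric_on_g: "pseudo_euclidean_metric_on (range \<beta>) g"
proof -
  have add: "g (\<beta> \<xi> + \<beta> \<eta>) Y = g (\<beta> \<xi>) Y + g (\<beta> \<eta>) Y" if "Y \<in> range \<beta>" for \<xi> \<eta> Y
    using that g_\<beta>[OF that, of "\<xi> + \<eta>"] by (simp add: g_\<beta> \<beta>_arith dual_apply_arith)
  have scale: "g (c *\<^sub>R \<beta> \<xi>) Y = c * g (\<beta> \<xi>) Y" if "Y \<in> range \<beta>" for c \<xi> Y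
    using that g_\<beta>[OF that, of "c *\<^sub>R \<xi>"] by (simp add: g_\<beta> \<beta>_arith dual_apply_arith)
  have "\<forall>X\<in>range \<beta>. linear_on (range \<beta>) (g X)"
    by (simp add: linear_on_def g_def dual_apply_arith)
  moreover have "\<forall>Y\<in>range \<beta>. linear_on (range \<beta>) (\<lambda>X. g X Y)"
    by (auto simp: linear_on_def add scale)
  moreover have "\<forall>X\<in>range \<beta>. \<forall>Y\<in>range \<beta>. g X Y = g Y X"
    by (auto simp: g_\<beta> intro: \<beta>_sym)
  moreover have "X = 0" if "X \<in> range \<beta>" "\<forall>Y\<in>range \<beta>. g X Y = 0" for X
  proof -
    obtain \<xi> where X: "X = \<beta> \<xi>" using \<open>X \<in> range \<beta>\<close> by blast
    then have "\<forall>Y\<in>range \<beta>. dual_apply \<xi> Y = dual_apply 0 Y"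
      using that by (simp add: g_\<beta> dual_apply_arith)
    then have "\<beta> \<xi> = \<beta> 0" by (simp only: \<beta>_eq_iff)
    then show "X = 0" by (simp add: X \<beta>_arith)
  qed
  ultimately show ?thesis by (auto simp: pseudo_euclidean_metric_on_def)
qed

text \<open>The inverse of the metric is \<beta> itself, so \<open>metric_gcs\<close> has the right
  upper block.\<close>

lemma inv_into_flat_map:
  "inv_into (range \<beta>) (flat_map (range \<beta>) g) (restrict (dual_apply \<xi>) (range \<beta>)) = \<beta> \<xi>"
proof -
  have "inj_on (flat_map (range \<beta>) g) (range \<beta>)"
  proof (rule inj_onI)
    fix X Y assume X: "X \<in> range \<beta>" and Y: "Y \<in> range \<beta>"
      and eq: "flat_map (range \<beta>) g X = flat_map (range \<beta>) g Y"
    have "g X Z = g Y Z" if "Z \<in> range \<beta>" for Z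
      using fun_cong[OF eq, of Z] that by (simp add: flat_map_def)
    then have "\<beta> (inv \<beta> X) = \<beta> (inv \<beta> Y)"
      unfolding \<beta>_eq_iff by (simp add: g_def)
    then show "X = Y" using X Y by (simp add: \<beta>_inv)
  qed
  moreover have "flat_map (range \<beta>) g (\<beta> \<xi>) = restrict (dual_apply \<xi>) (range \<beta>)"
    by (auto simp: flat_map_def fun_eq_iff restrict_def g_\<beta>)
  ultimately show ?thesis by (metis inv_into_f_f rangeI)
qed

section \<open>Effect of a \<open>B\<close>-field on the blocks, and choice of the first one\<close>

lemma B_field_transform_blocks:
  assumes "bilinear B"
  shows "tangent_block (B_field_transform B \<J>) X = A X - \<beta> (interior_mult X B)"
    and "bivector_block (B_field_transform B \<J>) = \<beta>"
    and "dual_apply (form_block (B_field_transform B \<J>) X) Y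
      = B (A X - \<beta> (interior_mult X B)) Y + \<sigma> X Y - B X (A Y)"
proof -
  note D = dual_apply_interior_mult[OF assms]
  have 0: "interior_mult 0 B = 0"
    by (intro dual_eqI) (simp add: D dual_apply_arith bilinear_lzero[OF assms])
  have E: "exp_form B x = (fst x, interior_mult (fst x) B + snd x)" for x
    by (simp add: exp_form_def case_prod_beta)
  have F: "B_field_transform B \<J> (X, \<xi>) = exp_form B (\<J> (X, \<xi> - interior_mult X B))" for X \<xi>
    by (simp add: B_field_transform_def exp_form_uminus[OF assms])
  show "tangent_block (B_field_transform B \<J>) X = A X - \<beta> (interior_mult X B)"
    unfolding tangent_block_def[of "B_field_transform B \<J>"]
    by (simp add: F E fst_J \<beta>_arith)
  show "bivector_block (B_field_transform B \<J>) = \<beta>"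
    by (rule ext) (simp add: bivector_block_def[of "B_field_transform B \<J>"] F E fst_J 0 A_arith)
  show "dual_apply (form_block (B_field_transform B \<J>) X) Y
      = B (A X - \<beta> (interior_mult X B)) Y + \<sigma> X Y - B X (A Y)"
    by (simp add: form_block_def[of "B_field_transform B \<J>"] F E fst_J snd_J D dual_apply_arith \<beta>_arith)
qed

text \<open>By the block formula it suffices that
  \<open>\<beta> (interior_mult X B) = p (A X)\<close>. The last conjunct says that \<open>A\<close>
  preserves \<Delta>, so the new tangent block vanishes there.\<close>

lemma ex_B_field_tangent_block:
  assumes p: "linear p" "range p = range \<beta>" "\<And>X. p (p X) = p X"
  shows "\<exists>B. two_form B \<and> tangent_block (B_field_transform B \<J>) = (\<lambda>X. A X - p (A X)) \<and>
    (\<forall>X. p (A (p X)) = A (p X))"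
proof -
  have p_in: "p X \<in> range \<beta>" for X using p(2) by blast
  have p_id: "p X = X" if "X \<in> range \<beta>" for X
    using that p by (metis imageE)
  have A_p: "A (p X) \<in> range \<beta>" for X
  proof -
    obtain \<xi> where "p X = \<beta> \<xi>" using p_in by blast
    then have "A (p X) = \<beta> (- snd (\<J> (0, \<xi>)))" by (simp add: A_\<beta> \<beta>_arith)
    then show ?thesis by simp
  qed
  \<comment> \<open>The first term alone gives the required contraction with \<Delta>. The second
    vanishes for \<open>Y\<close> in \<Delta> and makes the form alternating on mixed pairs; on the
    kernel of \<open>p\<close> both terms vanish.\<close>
  define B where "B X Y = g (p (A X)) (p Y) - g (p (A (Y - p Y))) (p X)" for X Y
  have g1: "linear (g X)" for X
    unfolding g_def by (rule linear_dual_apply)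
  \<comment> \<open>\<open>inv \<beta>\<close> need not be linear, so linearity in the first slot is
    taken from the metric on \<Delta>; \<open>p\<close> keeps both slots there.\<close>
  have g2: "linear (\<lambda>X. g (p (f X)) (p Y))" if "linear f" for f :: "'a \<Rightarrow> 'a" and Y
  proof -
    have "linear_on (range \<beta>) (\<lambda>X. g X (p Y))"
      using pseudo_euclidean_metric_on_g p_in[of Y] unfolding pseudo_euclidean_metric_on_def by blast
    then show ?thesis
      using p_in by (simp add: linear_on_def linear_iff linear_add[OF that]
          linear_cmul[OF that] linear_add[OF p(1)] linear_cmul[OF p(1)] del: ball_simps)
  qed
  have l: "linear (\<lambda>Y. A (Y - p Y))"
    by (simp add: linear_iff A_arith linear_add[OF p(1)] linear_cmul[OF p(1)] algebra_simps)
  have gp: "linear (\<lambda>Y. g X (p Y))" for X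
    using linear_compose[OF p(1) g1] by (simp add: o_def)
  have bil: "bilinear B"
    unfolding bilinear_def B_def
    by (intro conjI allI linear_compose_sub gp g2 linear_A l)
  \<comment> \<open>With \<open>p X = \<beta> \<xi>\<close>, moving \<open>A\<close> across by
    \<open>A_\<beta>\<close> shows that the number equals its own negative.\<close>
  have alt: "g (A (p X)) (p X) = 0" for X
  proof -
    obtain \<xi> where X: "p X = \<beta> \<xi>" using p_in by blast
    have "g (A (p X)) (p X) = dual_apply (- snd (\<J> (0, \<xi>))) (\<beta> \<xi>)"
      using g_\<beta>[of "\<beta> \<xi>" "- snd (\<J> (0, \<xi>))"] by (simp add: X A_\<beta> \<beta>_arith)
    also have "\<dots> = - dual_apply \<xi> (A (\<beta> \<xi>))"
      by (simp add: dual_apply_arith snd_J_0)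
    also have "dual_apply \<xi> (A (\<beta> \<xi>)) = g (\<beta> \<xi>) (A (\<beta> \<xi>))"
      using A_p[of X] by (simp add: X g_\<beta>)
    also have "\<dots> = g (A (p X)) (p X)"
      using pseudo_euclidean_metric_on_g A_p[of X] p_in[of X]
      unfolding X pseudo_euclidean_metric_on_def by blast
    finally show ?thesis by simp
  qed
  have "B X X = 0" for X
  proof -
    \<comment> \<open>The part of \<open>X\<close> outside \<Delta> cancels the second term of
      \<open>B\<close>; the part in \<Delta> contributes zero by \<open>alt\<close>.\<close>
    have "g (p (A X)) (p X) = g (p (A (p X))) (p X) + g (p (A (X - p X))) (p X)"
      using linear_add[OF g2[OF linear_A], of "p X" "X - p X" X] by simp
    then show ?thesis by (simp add: B_def p_id A_p alt)
  qed
  then have "two_form B" using bil by (simp add: two_form_def)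
  moreover have "\<beta> (interior_mult X B) = p (A X)" for X
  proof -
    \<comment> \<open>Only values on the image of \<beta> matter, and there \<open>B X Y\<close> is
      \<open>g (p (A X)) Y\<close>.\<close>
    have "\<beta> (interior_mult X B) = \<beta> (inv \<beta> (p (A X)))"
      unfolding \<beta>_eq_iff using linear_0[OF p(1)] linear_0[OF g2[OF linear_A]]
      by (auto simp: dual_apply_interior_mult[OF bil] B_def p_id A_arith)
        (simp_all add: g_def)
    then show ?thesis using p_in by (simp add: \<beta>_inv)
  qed
  ultimately show ?thesis
    using bil by (intro exI[of _ B]) (auto simp: B_field_transform_blocks p_id A_p)
qed

section \<open>Splitting along the image of \<beta> and the kernel of the projection\<close>

text \<open>Once \<open>A\<close> kills \<Delta> and maps into \<open>N\<close>, only \<sigma> on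
  \<open>N\<close> can obstruct the splitting. The fourth claim ensures that the second
  transformation leaves \<open>A\<close> unchanged.\<close>

lemma direct_sum_gcs_range_kernel:
  assumes p: "linear p" "range p = range \<beta>" "\<And>X. p (p X) = p X"
    and A_p: "\<And>X. A (p X) = 0" and p_A: "\<And>X. p (A X) = 0"
  defines "N \<equiv> {X. p X = 0}"
  shows "is_direct_sum (range \<beta>) N" "complex_structure_on N A"
    and "(\<And>X Y. X \<in> N \<Longrightarrow> Y \<in> N \<Longrightarrow> \<sigma> X Y = 0) \<Longrightarrow>
      \<J> = direct_sum_gcs (range \<beta>) N (metric_gcs (range \<beta>) g) (complex_gcs N A)"
    and "\<And>X. \<beta> (form_block \<J> (A X)) = 0"
proof -
  have p_in: "p X \<in> range \<beta>" for X using p(2) by blast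
  have p_id: "p X = X" if "X \<in> range \<beta>" for X
    using that p by (metis imageE)
  have q_in: "X - p X \<in> N" for X
    by (simp add: N_def linear_diff[OF p(1)] p)
  have subN: "subspace N"
    unfolding N_def by (rule linear_subspace_kernel[OF p(1)])
  have sub: "subspace (range \<beta>)"
    by (rule linear_subspace_image[OF linear_\<beta> subspace_UNIV])
  have int: "range \<beta> \<inter> N = {0}"
    using p_id subspace_0[OF subN] subspace_0[OF sub] by (auto simp: N_def)
  have "X \<in> {X + Y |X Y. X \<in> range \<beta> \<and> Y \<in> N}" for X
    using p_in[of X] q_in[of X]
    by (intro CollectI exI[of _ "p X"] exI[of _ "X - p X"]) simp
  then show ds: "is_direct_sum (range \<beta>) N"
    using sub subN int by (auto simp: is_direct_sum_def)
  have sqN: "A (A X) = - X" if "X \<in> N" for X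
  proof -
    \<comment> \<open>In \<open>A_square\<close> the \<beta> term lies in \<Delta> and the other
      terms lie in \<open>N\<close>, so applying \<open>p\<close> isolates it and shows that it is
      zero.\<close>
    have "p (\<beta> (form_block \<J> X)) = p (- X - A (A X))"
      by (rule arg_cong[of _ _ p]) (simp add: A_square[symmetric])
    then have "\<beta> (form_block \<J> X) = 0"
      using that linear_diff[OF p(1)] linear_neg[OF p(1)] by (simp add: p_id p_A N_def)
    then show ?thesis using A_square[of X] by simp
  qed
  then show "complex_structure_on N A"
    by (auto simp: complex_structure_on_def linear_on_def A_arith N_def p_A)
  have "A X \<in> N" for X by (simp add: N_def p_A)
  then show "\<beta> (form_block \<J> (A X)) = 0" for X
    using A_square[of "A X"] sqN[of "A X"] by simp
  assume \<sigma>0: "\<And>X Y. X \<in> N \<Longrightarrow> Y \<in> N \<Longrightarrow> \<sigma> X Y = 0"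
  have proj1: "proj_along (range \<beta>) N X = p X" for X
    unfolding proj_along_def
    using p_in q_in by (intro the_equality) (auto simp: N_def linear_diff[OF p(1)] p_id)
  have proj2: "proj_along N (range \<beta>) X = X - p X" for X
    unfolding proj_along_def
  proof (intro the_equality)
    show "X - p X \<in> N \<and> X - (X - p X) \<in> range \<beta>"
      using p_in q_in by simp
    fix Y assume Y: "Y \<in> N \<and> X - Y \<in> range \<beta>"
    then have "p (X - Y) = X - Y" by (simp add: p_id)
    then show "Y = X - p X" using Y by (simp add: linear_diff[OF p(1)] N_def)
  qed
  \<comment> \<open>Since \<open>A\<close> vanishes on \<Delta>, \<open>A_square\<close> makes
    \<open>- form_block \<J> (p X)\<close> a preimage of \<open>p X\<close> under \<beta>.\<close>
  have \<sigma>1: "\<sigma> (p X) Y = - g (p X) Y" if "Y \<in> range \<beta>" for X Y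
  proof -
    have "\<beta> (- form_block \<J> (p X)) = p X"
      using A_square[of "p X"] by (simp add: A_p A_arith \<beta>_arith)
    then show ?thesis using g_\<beta>[OF that, of "- form_block \<J> (p X)"]
      by (simp add: dual_apply_arith)
  qed
  \<comment> \<open>For \<open>X\<close> in \<open>N\<close> the covector
    \<open>form_block \<J> X\<close> lies in the kernel of \<beta>, which annihilates the image of
    \<beta> by symmetry.\<close>
  have \<sigma>2: "\<sigma> X (p Y) = 0" if "X \<in> N" for X Y
  proof -
    obtain \<xi> where "p Y = \<beta> \<xi>" using p_in by blast
    moreover have "\<beta> (form_block \<J> X) = 0"
      using A_square[of X] sqN[OF that] by simp
    ultimately show ?thesis using \<beta>_sym[of "form_block \<J> X" \<xi>] by (simp add: dual_apply_arith)
  qed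
  have \<sigma>: "\<sigma> X Y = - g (p X) (p Y)" for X Y
  proof -
    have "\<sigma> X Y = \<sigma> (p X + (X - p X)) (p Y + (Y - p Y))" by simp
    also have "\<dots> = \<sigma> (p X) (p Y) + \<sigma> (Y - p Y) (p X) + \<sigma> (X - p X) (p Y)
        + \<sigma> (X - p X) (Y - p Y)"
      by (simp only: \<sigma>_arith(1) dual_apply_arith(1) plus_dual_space.rep_eq \<sigma>_sym[of "p X" "Y - p Y"])
    also have "\<dots> = - g (p X) (p Y)"
      by (simp only: \<sigma>1 \<sigma>2 \<sigma>0 q_in p_in)
    finally show ?thesis .
  qed
  have A_q: "A (X - p X) = A X" for X by (simp add: A_arith A_p)
  have "\<J> (X, \<xi>) =
    direct_sum_gcs (range \<beta>) N (metric_gcs (range \<beta>) g) (complex_gcs N A) (X, \<xi>)" for X \<xi>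
  proof -
    have "direct_sum_gcs (range \<beta>) N (metric_gcs (range \<beta>) g) (complex_gcs N A) (X, \<xi>)
        = (\<beta> \<xi> + A X, Dual (\<lambda>Y. - g (p X) (p Y) + dual_apply \<xi> (A Y)))"
      using p_in q_in \<open>\<And>X. A X \<in> N\<close>
      by (simp add: direct_sum_gcs_def join_double_def split_double_def metric_gcs_def
          complex_gcs_def proj1 proj2 inv_into_flat_map A_q)
        (simp add: flat_map_def)
    also have "(\<lambda>Y. - g (p X) (p Y) + dual_apply \<xi> (A Y)) = dual_apply (snd (\<J> (X, \<xi>)))"
      by (simp add: fun_eq_iff snd_J \<sigma>)
    finally show ?thesis
      by (simp add: dual_apply_inverse prod_eq_iff fst_J add.commute)
  qed
  then show "\<J> = direct_sum_gcs (range \<beta>) N (metric_gcs (range \<beta>) g) (complex_gcs N A)"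
    by (simp add: fun_eq_iff split_paired_all)
qed

end

section \<open>Combining the two transformations\<close>

theorem theorem7:
  fixes \<J> :: "('a::real_vector) \<times> 'a dual_space \<Rightarrow> 'a \<times> 'a dual_space"
  assumes "\<exists>Bs :: 'a set. finite Bs \<and> span Bs = UNIV"
    and "sym_gen_complex_structure \<J>"
  shows "\<exists>(\<Delta> :: 'a set) (N :: 'a set) (g :: 'a \<Rightarrow> 'a \<Rightarrow> real) (J :: 'a \<Rightarrow> 'a) (B :: 'a \<Rightarrow> 'a \<Rightarrow> real).
           is_direct_sum \<Delta> N \<and>
           pseudo_euclidean_metric_on \<Delta> g \<and>
           complex_structure_on N J \<and>
           two_form B \<and>
           B_field_transform B \<J> = direct_sum_gcs \<Delta> N (metric_gcs \<Delta> g) (complex_gcs N J)"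
proof -
  interpret J0: sgcs \<J> using assms(2) by unfold_locales
  let ?\<Delta> = "range (bivector_block \<J>)"
  have "subspace ?\<Delta>"
    by (rule linear_subspace_image[OF J0.linear_\<beta> subspace_UNIV])
  \<comment> \<open>A left inverse of the inclusion of \<Delta> is a projection onto \<Delta>; its
    kernel serves as \<open>N\<close>.\<close>
  then obtain p :: "'a \<Rightarrow> 'a" where p: "range p \<subseteq> ?\<Delta>" "linear p" "\<forall>X\<in>?\<Delta>. p X = X"
    using linear_exists_left_inverse_on[OF linear_id, of ?\<Delta>] by auto
  have range_p: "range p = ?\<Delta>"
    using p(1,3) by (metis image_eqI subsetI subset_antisym UNIV_I)
  have p_idem: "p (p X) = p X" for X using p(1,3) by blast
  obtain B where B: "two_form B"
    "tangent_block (B_field_transform B \<J>) = (\<lambda>X. J0.A X - p (J0.A X))"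
    "\<And>X. p (J0.A (p X)) = J0.A (p X)"
    using J0.ex_B_field_tangent_block[OF p(2) range_p p_idem] by blast
  have bilB: "bilinear B" using B(1) by (simp add: two_form_def)
  interpret J1: sgcs "B_field_transform B \<J>"
    using assms(2) B(1) by unfold_locales (rule sym_gen_complex_structure_B_field_transform)
  have \<beta>1: "J1.\<beta> = J0.\<beta>" by (rule J0.B_field_transform_blocks(2)[OF bilB])
  have A_p: "J1.A (p X) = 0" and p_A: "p (J1.A X) = 0" for X
    by (simp_all add: B(2,3) linear_diff[OF p(2)] p_idem)
  let ?N = "{X. p X = 0}"
  note nf1 = J1.direct_sum_gcs_range_kernel[OF p(2) range_p[folded \<beta>1] p_idem A_p p_A]
  \<comment> \<open>On \<open>N\<close> the change in \<sigma> is
    \<open>C (A X) Y - C X (A Y)\<close>. Both terms equal minus one half of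
    \<open>\<sigma> X Y\<close>, because \<open>A\<close> squares to -1 and
    \<open>\<sigma> (A X) (A Y) = \<sigma> X Y\<close>; hence the factor 1/2.\<close>
  define C where "C X Y = J1.\<sigma> (J1.A X) Y / 2" for X Y
  have bilC: "bilinear C"
    unfolding bilinear_def C_def
    by (simp add: linear_iff J1.\<sigma>_arith J1.A_arith add_divide_distrib)
  \<comment> \<open>\<open>\<sigma>_A\<close> and the symmetry of \<sigma> give
    \<open>\<sigma> (A X) X = - \<sigma> (A X) X\<close>.\<close>
  have "C X X = 0" for X
    using J1.\<sigma>_A[of X X] J1.\<sigma>_sym[of X "J1.A X"] by (simp add: C_def)
  then have C: "two_form C" using bilC by (simp add: two_form_def)
  \<comment> \<open>The contraction is half of the covector killed by \<beta> in the fourth claim of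
    the splitting lemma, so the tangent block survives.\<close>
  have \<beta>C: "J0.\<beta> (interior_mult X C) = 0" for X
  proof -
    have "interior_mult X C = (1/2) *\<^sub>R form_block (B_field_transform B \<J>) (J1.A X)"
      by (intro dual_eqI)
        (simp add: dual_apply_interior_mult[OF bilC] C_def dual_apply_arith)
    then show ?thesis using nf1(4)[of X] by (simp add: \<beta>1 J0.\<beta>_arith)
  qed
  let ?J2 = "B_field_transform C (B_field_transform B \<J>)"
  interpret J2: sgcs ?J2
    using J1.sgcs C by unfold_locales (rule sym_gen_complex_structure_B_field_transform)
  note blocks = J1.B_field_transform_blocks[OF bilC, unfolded \<beta>1 \<beta>C diff_zero]
  have A2: "J2.A = J1.A" using blocks(1) by blast
  have \<beta>2: "J2.\<beta> = J0.\<beta>" by (rule blocks(2))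
  have "J2.\<sigma> X Y = 0" if "X \<in> ?N" "Y \<in> ?N" for X Y
  proof -
    have sq: "J1.A (J1.A X) = - X" "J1.A (J1.A Y) = - Y"
      using nf1(2) that by (auto simp: complex_structure_on_def)
    have "J1.\<sigma> (J1.A X) (J1.A Y) = J1.\<sigma> X Y"
      using J1.\<sigma>_A[of X "J1.A Y"] by (simp add: sq dual_apply_arith)
    then show ?thesis by (simp add: blocks(3) C_def sq J1.\<sigma>_arith)
  qed
  note nf2 = J2.direct_sum_gcs_range_kernel[unfolded A2 \<beta>2, OF p(2) range_p p_idem A_p p_A]
  have "?J2 = direct_sum_gcs ?\<Delta> ?N (metric_gcs ?\<Delta> J2.g) (complex_gcs ?N J1.A)"
    by (rule nf2(3)) fact
  moreover have "two_form (\<lambda>X Y. B X Y + C X Y)"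
    using B(1) C by (auto simp: two_form_def bilinear_def intro: linear_compose_add)
  moreover have "pseudo_euclidean_metric_on ?\<Delta> J2.g"
    using J2.pseudo_euclidean_metric_on_g by (simp only: \<beta>2)
  ultimately show ?thesis
    using nf2(1,2) unfolding B_field_transform_add[OF bilB bilC] by blast
qed

end
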